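(* Suppose that $Q$ is a basic sequence that is infinite in limit and that $f$ is an asymptotic distribution function. Then the set of real numbers $x$ such that the sequence $(T_{Q,n}(x))_{n=0}^\infty$ has asymptotic distribution function $f$ has Hausdorff dimension $1$.
   Context: A basic sequence is $Q=(q_n)_{n\ge1}$ with integers $q_n\ge2$; infinite in limit means $q_n\to\infty$. $T_{Q,n}(x)=q_nq_{n-1}\cdots q_1x\bmod 1$. An asymptotic distribution function (adf) is a non-decreasing $f:[0,1]\to[0,1]$ with $f(0)=0$, $f(1)=1$; a sequence $\omega=(x_i)$ in $[0,1)$ has adf $f$ if $\lim_{n\to\infty}\#\{i\le n:x_i\in[0,x)\}/n=f(x)$ for all $x\in[0,1]$. *)

theory Defs
  imports "HOL-Analysis.Analysis"
begin

text \<open>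
  The term \<open>|U|\<^sup>s\<close> in the sums defining Hausdorff measure.  For \<open>s = 0\<close> it is 1 on nonempty sets
  and 0 on the empty set; \<^term>\<open>0 powr 0 = (0::real)\<close> would give the wrong value on singletons.
\<close>
definition hausdorff_gauge :: "real \<Rightarrow> 'a::metric_space set \<Rightarrow> ennreal" where
  "hausdorff_gauge s U =
     (if U = {} then 0 else if s = 0 then 1 else ennreal (diameter U powr s))"

text \<open>
  Covering sets are required to be bounded because \<^const>\<open>diameter\<close> is unspecified on unbounded
  sets.  Finite covers are included, as members of the sequence may be empty.
\<close>
definition hausdorff_premeasure :: "real \<Rightarrow> real \<Rightarrow> 'a::metric_space set \<Rightarrow> ennreal" where
  "hausdorff_premeasure s \<delta> E =
     (INF C \<in> {C :: nat \<Rightarrow> 'a set. E \<subseteq> (\<Union>i. C i) \<and> (\<forall>i. bounded (C i) \<and> diameter (C i) \<le> \<delta>)}.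
        \<Sum>i. hausdorff_gauge s (C i))"

text \<open>
  The premeasure increases as \<open>\<delta>\<close> decreases, so the supremum is the limit for \<open>\<delta> \<rightarrow> 0\<close>.
\<close>
definition hausdorff_measure :: "real \<Rightarrow> 'a::metric_space set \<Rightarrow> ennreal" where
  "hausdorff_measure s E = (SUP \<delta> \<in> {0<..}. hausdorff_premeasure s \<delta> E)"

definition hausdorff_dim :: "'a::metric_space set \<Rightarrow> ennreal" where
  "hausdorff_dim E = (INF s \<in> {s. 0 \<le> s \<and> hausdorff_measure s E = 0}. ennreal s)"

text \<open>
  Basic sequences are indexed from 1; the value at index 0 is never used.
\<close>
definition basic_sequence :: "(nat \<Rightarrow> nat) \<Rightarrow> bool" where
  "basic_sequence Q \<longleftrightarrow> (\<forall>n\<ge>1. Q n \<ge> 2)"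

definition infinite_in_limit :: "(nat \<Rightarrow> nat) \<Rightarrow> bool" where
  "infinite_in_limit Q \<longleftrightarrow> filterlim Q at_top sequentially"

definition cantor_T :: "(nat \<Rightarrow> nat) \<Rightarrow> nat \<Rightarrow> real \<Rightarrow> real" where
  "cantor_T Q n x = frac (real (\<Prod>i=1..n. Q i) * x)"

definition is_adf :: "(real \<Rightarrow> real) \<Rightarrow> bool" where
  "is_adf f \<longleftrightarrow> f \<in> {0..1} \<rightarrow> {0..1} \<and> mono_on {0..1} f \<and> f 0 = 0 \<and> f 1 = 1"

text \<open>
  Sequences are indexed from 0, so the first \<open>n\<close> terms are those with index \<open>i < n\<close>.
\<close>
definition has_adf :: "(nat \<Rightarrow> real) \<Rightarrow> (real \<Rightarrow> real) \<Rightarrow> bool" where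
  "has_adf \<omega> f \<longleftrightarrow>
     (\<forall>x\<in>{0..1}. (\<lambda>n. real (card {i. i < n \<and> \<omega> i \<in> {0..<x}}) / real n) \<longlonglongrightarrow> f x)"

end

theory Submission
  imports Defs "HOL-Real_Asymp.Real_Asymp"
begin

text \<open>
  Write \<open>q n = Q (n + 1)\<close>. Choose integers \<open>R n \<rightarrow> \<infinity>\<close> growing much slower than \<open>q\<close>, put
  \<open>M n = q n div R n\<close>, and allow as \<open>n\<close>-th Cantor digit only the \<open>M n\<close> consecutive values
  \<open>a n, \<dots>, a n + M n - 1\<close>. This forces \<open>T\<^sub>n(x)\<close> into an interval of length about \<open>1 / R n\<close>, whose
  position is free. We put it next to the \<open>u n\<close>-quantile of \<open>f\<close>, where \<open>u\<close> is the equidistributed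
  van der Corput sequence, and on the side of the quantile that \<open>u n\<close> dictates, so that the values of
  \<open>f\<close> at its jumps come out right. Every \<open>x\<close> with allowed digits then has distribution function \<open>f\<close>.

  Reading the Cantor digits of \<open>t \<in> [0,1)\<close> for the bases \<open>M\<close> as positions among the allowed digits
  gives a map \<open>h\<close> from \<open>[0,1)\<close> into this set with \<open>|t - t'| \<le> C |h t - h t'|\<^sup>s\<close> for every \<open>s < 1\<close>. A cover
  of the set pulls back to a cover of \<open>[0,1)\<close>, and comparison with Lebesgue measure bounds the
  \<open>s\<close>-dimensional Hausdorff measure away from 0.
\<close>

section \<open>Hausdorff measure on the line\<close>

text \<open>A cover of \<open>E\<close> pulls back along \<open>h\<close> to a cover of [0,1) by
  sets contained in intervals of length 2C times the s-th powers of the diameters. These lengths add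
  up to at least 1, so every cover has gauge sum at least 1/(2C).\<close>

lemma hausdorff_measure_pos_of_inverse_Holder:
  fixes h :: "real \<Rightarrow> 'a::metric_space"
  assumes s: "0 < s" and C: "0 < C"
    and h: "h ` {0..<1} \<subseteq> E"
    and holder: "\<And>t t'. t \<in> {0..<1} \<Longrightarrow> t' \<in> {0..<1} \<Longrightarrow> \<bar>t - t'\<bar> \<le> C * dist (h t) (h t') powr s"
  shows "hausdorff_measure s E \<noteq> 0"
proof
  assume zero: "hausdorff_measure s E = 0"
  have lower: "ennreal (1 / (2 * C)) \<le> (\<Sum>i. hausdorff_gauge s (A i))"
    if cover: "E \<subseteq> (\<Union>i. A i)" and bdd: "\<And>i. bounded (A i)" for A :: "nat \<Rightarrow> 'a set"
  proof -
    define S where "S i = {t \<in> {0..<1}. h t \<in> A i}" for i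
    define c where "c i = (SOME t. t \<in> S i)" for i
    \<comment> \<open>As \<open>h\<close> is arbitrary, the preimage \<open>S i\<close> need not be
      measurable; it is enclosed in an interval around one of its points.\<close>
    define B where "B i = (if S i = {} then {} else {c i - C * diameter (A i) powr s .. c i + C * diameter (A i) powr s})" for i
    have SB: "S i \<subseteq> B i" for i
    proof
      fix t assume t: "t \<in> S i"
      then have c: "c i \<in> S i" unfolding c_def by (metis someI)
      have "dist (h t) (h (c i)) \<le> diameter (A i)"
        using t c bdd[of i] by (auto simp: S_def intro: diameter_bounded_bound)
      then have "dist (h t) (h (c i)) powr s \<le> diameter (A i) powr s"
        using s by (intro powr_mono2) auto
      then have "\<bar>t - c i\<bar> \<le> C * diameter (A i) powr s"
        using holder[of t "c i"] t c C unfolding S_def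
        by (smt (verit, best) mem_Collect_eq mult_left_mono)
      then show "t \<in> B i" using t by (auto simp: B_def)
    qed
    have "{0..<1} \<subseteq> (\<Union>i. B i)"
    proof
      fix t :: real assume t: "t \<in> {0..<1}"
      then obtain i where "h t \<in> A i" using h cover by blast
      then show "t \<in> (\<Union>i. B i)" using t SB[of i] by (auto simp: S_def)
    qed
    moreover have Bm: "B i \<in> sets lborel" for i by (auto simp: B_def)
    ultimately have "emeasure lborel {0..<1::real} \<le> emeasure lborel (\<Union>i. B i)"
      by (intro emeasure_mono sets.countable_UN) auto
    also have "\<dots> \<le> (\<Sum>i. emeasure lborel (B i))"
      using Bm by (intro emeasure_subadditive_countably) auto
    also have "\<dots> \<le> (\<Sum>i. ennreal (2 * C) * hausdorff_gauge s (A i))"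
    proof (intro suminf_le summableI)
      fix i
      show "emeasure lborel (B i) \<le> ennreal (2 * C) * hausdorff_gauge s (A i)"
      proof (cases "S i = {}")
        case False
        then have "A i \<noteq> {}" by (auto simp: S_def)
        then show ?thesis using s C False
          by (auto simp: B_def hausdorff_gauge_def ennreal_mult[symmetric])
      qed (simp add: B_def)
    qed
    also have "\<dots> = ennreal (2 * C) * (\<Sum>i. hausdorff_gauge s (A i))"
      by simp
    finally have "1 \<le> ennreal (2 * C) * (\<Sum>i. hausdorff_gauge s (A i))" by simp
    then have "ennreal (1 / (2 * C)) * 1 \<le> ennreal (1 / (2 * C)) * (ennreal (2 * C) * (\<Sum>i. hausdorff_gauge s (A i)))"
      by (rule mult_left_mono) simp
    also have "\<dots> = ennreal (1 / (2 * C) * (2 * C)) * (\<Sum>i. hausdorff_gauge s (A i))"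
      using C by (subst ennreal_mult) (auto simp: mult.assoc)
    finally show ?thesis using C by simp
  qed
  have "ennreal (1 / (2 * C)) \<le> hausdorff_premeasure s 1 E"
    unfolding hausdorff_premeasure_def by (rule INF_greatest) (use lower in blast)
  also have "\<dots> \<le> hausdorff_measure s E"
    unfolding hausdorff_measure_def by (rule SUP_upper) simp
  finally show False using zero C by simp
qed

text \<open>The Hoelder criterion needs a positive exponent, so exponent 0 is treated apart: a cover
  of a nonempty set has a nonempty member, and its gauge is 1.\<close>

lemma hausdorff_measure_0_nonempty:
  fixes E :: "'a::metric_space set"
  assumes "E \<noteq> {}"
  shows "hausdorff_measure 0 E \<noteq> 0"
proof
  assume zero: "hausdorff_measure 0 E = 0"
  have "1 \<le> hausdorff_premeasure 0 1 E"
    unfolding hausdorff_premeasure_def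
  proof (rule INF_greatest)
    fix A :: "nat \<Rightarrow> 'a set"
    assume "A \<in> {C. E \<subseteq> (\<Union>i. C i) \<and> (\<forall>i. bounded (C i) \<and> diameter (C i) \<le> 1)}"
    then obtain i where "A i \<noteq> {}" using assms by fastforce
    then have "1 \<le> hausdorff_gauge 0 (A i)" by (simp add: hausdorff_gauge_def)
    also have "\<dots> \<le> (\<Sum>i. hausdorff_gauge 0 (A i))"
      using sum_le_suminf[OF summableI, of "{i}" "\<lambda>i. hausdorff_gauge 0 (A i)"] by simp
    finally show "1 \<le> (\<Sum>i. hausdorff_gauge 0 (A i))" .
  qed
  also have "\<dots> \<le> hausdorff_measure 0 E"
    unfolding hausdorff_measure_def by (rule SUP_upper) simp
  finally show False using zero by simp
qed

lemma hausdorff_measure_mono: "E \<subseteq> F \<Longrightarrow> hausdorff_measure s E \<le> hausdorff_measure s F"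
  unfolding hausdorff_measure_def hausdorff_premeasure_def
  by (intro SUP_mono' INF_superset_mono) auto

text \<open>The harmonic series diverges, so there is a least index at which its scaled partial sums
  reach \<open>x\<close>; the predecessor of that index is the required \<open>k\<close>.\<close>

lemma real_between_harm:
  assumes "0 < \<eta>" and "0 \<le> (x::real)"
  obtains k where "\<eta> * harm k \<le> x" "x \<le> \<eta> * harm (Suc k)"
proof -
  have "filterlim (harm :: nat \<Rightarrow> real) at_top sequentially" by (rule harm_at_top)
  then have ex: "\<exists>k. x / \<eta> \<le> harm k"
    using eventually_happens[OF filterlim_at_top[THEN iffD1, rule_format, of "harm :: nat \<Rightarrow> real" sequentially "x / \<eta>"]] by auto
  define m where "m = (LEAST k. x / \<eta> \<le> harm k)"
  have m: "x / \<eta> \<le> harm m" unfolding m_def using ex by (rule LeastI_ex)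
  show ?thesis
  proof (cases m)
    case 0
    then have "x = 0" using m assms by (simp add: harm_def field_simps)
    then show ?thesis using assms that[of 0] by (simp add: harm_def)
  next
    case (Suc k)
    then have "\<not> x / \<eta> \<le> harm k" using not_less_Least[of k] unfolding m_def by (metis lessI)
    then show ?thesis using m Suc assms that[of k] by (simp add: field_simps)
  qed
qed

text \<open>
  The lengths \<open>\<eta> / (i + 1)\<close> have infinite sum, so intervals of these lengths tile the line, while the
  sum of their \<open>s\<close>-th powers is finite and tends to 0 with \<open>\<eta>\<close>.
\<close>
lemma hausdorff_measure_real_UNIV:
  assumes s: "1 < s"
  shows "hausdorff_measure s (UNIV :: real set) = 0"
proof -
  define Z where "Z = (\<Sum>i. real (Suc i) powr - s)"
  have sm: "summable (\<lambda>i. real (Suc i) powr - s)"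
    using s by (subst summable_Suc_iff) (simp add: summable_real_powr_iff)
  have bound: "hausdorff_premeasure s \<delta> (UNIV :: real set) \<le> ennreal ((2 * \<eta>) powr s * Z)"
    if \<eta>: "0 < \<eta>" "\<eta> \<le> \<delta>" for \<eta> \<delta> :: real
  proof -
    \<comment> \<open>Even indices tile the nonnegative half-line, odd indices its mirror
      image.\<close>
    define A where "A i = (if even i then {\<eta> * harm (i div 2) .. \<eta> * harm (Suc (i div 2))}
      else {- (\<eta> * harm (Suc (i div 2))) .. - (\<eta> * harm (i div 2))})" for i :: nat
    have len: "\<eta> * harm (Suc k) = \<eta> * harm k + \<eta> / real (Suc k)" for k
      by (simp add: harm_Suc distrib_left divide_inverse)
    have diam: "diameter (A i) = \<eta> / real (Suc (i div 2))" for i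
    proof -
      have "0 \<le> \<eta> / real (Suc (i div 2))" using \<eta> by simp
      then show ?thesis using len[of "i div 2"] by (auto simp: A_def simp del: of_nat_Suc)
    qed
    have diam2: "diameter (A i) \<le> 2 * \<eta> / real (Suc i)" for i
    proof -
      have "Suc i \<le> 2 * Suc (i div 2)" by presburger
      then have "real (Suc i) \<le> 2 * real (Suc (i div 2))" by (metis of_nat_le_iff of_nat_mult of_nat_numeral)
      then show ?thesis unfolding diam using \<eta> by (simp add: field_simps del: of_nat_Suc)
    qed
    have "x \<in> (\<Union>i. A i)" for x
    proof (cases "0 \<le> x")
      case True
      obtain k where "\<eta> * harm k \<le> x" "x \<le> \<eta> * harm (Suc k)"
        using real_between_harm[OF \<eta>(1) True] .
      then have "x \<in> A (2 * k)" by (simp add: A_def)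
      then show ?thesis by blast
    next
      case False
      then have "0 \<le> - x" by simp
      then obtain k where "\<eta> * harm k \<le> - x" "- x \<le> \<eta> * harm (Suc k)"
        using real_between_harm[OF \<eta>(1)] by blast
      then have "x \<in> A (2 * k + 1)" by (simp add: A_def)
      then show ?thesis by blast
    qed
    moreover have "bounded (A i)" for i by (simp add: A_def)
    moreover have "diameter (A i) \<le> \<delta>" for i
    proof -
      have "\<eta> / real (Suc (i div 2)) \<le> \<eta> / 1" using \<eta> by (intro divide_left_mono) auto
      then show ?thesis unfolding diam using \<eta> by simp
    qed
    ultimately have "hausdorff_premeasure s \<delta> (UNIV :: real set) \<le> (\<Sum>i. hausdorff_gauge s (A i))"
      unfolding hausdorff_premeasure_def by (intro INF_lower) auto
    also have "\<dots> \<le> (\<Sum>i. ennreal ((2 * \<eta>) powr s * real (Suc i) powr - s))"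
    proof (intro suminf_le summableI)
      fix i
      have "diameter (A i) powr s \<le> (2 * \<eta> / real (Suc i)) powr s"
        using diam2[of i] diam[of i] \<eta> s by (intro powr_mono2) auto
      also have "\<dots> = (2 * \<eta>) powr s * real (Suc i) powr - s"
        using \<eta> powr_divide[of "2 * \<eta>" "real (Suc i)" s] by (simp add: powr_minus_divide)
      finally show "hausdorff_gauge s (A i) \<le> ennreal ((2 * \<eta>) powr s * real (Suc i) powr - s)"
        using s by (auto simp: hausdorff_gauge_def intro!: ennreal_leI)
    qed
    also have "\<dots> = ennreal (\<Sum>i. (2 * \<eta>) powr s * real (Suc i) powr - s)"
      using sm by (intro suminf_ennreal2 summable_mult) auto
    also have "(\<Sum>i. (2 * \<eta>) powr s * real (Suc i) powr - s) = (2 * \<eta>) powr s * Z"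
      unfolding Z_def using sm by (rule suminf_mult)
    finally show ?thesis .
  qed
  \<comment> \<open>For fixed \<open>\<delta>\<close> the bound holds for all \<open>\<eta>\<close>
    up to \<open>\<delta>\<close>, so \<open>\<eta>\<close> may tend to 0.\<close>
  have "hausdorff_premeasure s \<delta> (UNIV :: real set) \<le> 0" if "0 < \<delta>" for \<delta>
  proof (rule tendsto_lowerbound)
    have "((\<lambda>\<eta>. (2 * \<eta>) powr s * Z) \<longlongrightarrow> 0) (at_right 0)"
      using s by real_asymp
    then show "((\<lambda>\<eta>. ennreal ((2 * \<eta>) powr s * Z)) \<longlongrightarrow> 0) (at_right 0)"
      by (metis ennreal_0 tendsto_ennrealI)
    show "\<forall>\<^sub>F \<eta> in at_right 0. hausdorff_premeasure s \<delta> (UNIV :: real set) \<le> ennreal ((2 * \<eta>) powr s * Z)"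
      using that bound by (auto simp: eventually_at_right intro!: exI[of _ \<delta>])
  qed simp
  then show ?thesis unfolding hausdorff_measure_def
    by (intro antisym SUP_least) auto
qed

text \<open>The upper bound is automatic on the line: every exponent above 1 annihilates all of it,
  and these exponents come arbitrarily close to 1. The assumption excludes all exponents below 1
  from the infimum.\<close>

lemma hausdorff_dim_real_eq_1:
  fixes E :: "real set"
  assumes "\<And>s. 0 \<le> s \<Longrightarrow> s < 1 \<Longrightarrow> hausdorff_measure s E \<noteq> 0"
  shows "hausdorff_dim E = 1"
proof (rule antisym)
  have le: "hausdorff_dim E \<le> ennreal s" if "1 < s" for s
    unfolding hausdorff_dim_def
  proof (rule INF_lower)
    have "hausdorff_measure s E \<le> hausdorff_measure s (UNIV :: real set)" by (intro hausdorff_measure_mono) simp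
    then show "s \<in> {s. 0 \<le> s \<and> hausdorff_measure s E = 0}"
      using that hausdorff_measure_real_UNIV[OF that] by simp
  qed
  have "\<forall>\<^sub>F s in at_right 1. hausdorff_dim E \<le> ennreal s"
    using eventually_at_right_less[of "1 :: real"] by eventually_elim (rule le)
  moreover have "((\<lambda>s. ennreal s) \<longlongrightarrow> ennreal 1) (at_right 1)"
    by (intro tendsto_ennrealI tendsto_ident_at)
  ultimately show "hausdorff_dim E \<le> 1"
    using tendsto_lowerbound[of ennreal "ennreal 1" "at_right (1::real)" "hausdorff_dim E"] by simp
  show "1 \<le> hausdorff_dim E"
    unfolding hausdorff_dim_def
  proof (rule INF_greatest)
    fix s :: real assume "s \<in> {s. 0 \<le> s \<and> hausdorff_measure s E = 0}"
    then have "1 \<le> s" using assms[of s] by force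
    then show "1 \<le> ennreal s" by (simp add: ennreal_leI)
  qed
qed

section \<open>The van der Corput sequence\<close>

text \<open>Reflects the binary expansion of \<open>n\<close> in the radix point: the last bit of
  \<open>n\<close> becomes the first bit after the point.\<close>

fun van_der_corput :: "nat \<Rightarrow> real" where
  "van_der_corput n = (if n = 0 then 0 else van_der_corput (n div 2) / 2 + (if odd n then 1/2 else 0))"

declare van_der_corput.simps [simp del]

lemma van_der_corput_double:
  "van_der_corput (2 * n) = van_der_corput n / 2"
  "van_der_corput (2 * n + 1) = van_der_corput n / 2 + 1/2"
  using van_der_corput.simps[of "2 * n"] van_der_corput.simps[of "2 * n + 1"] van_der_corput.simps[of 0]
  by (cases "n = 0"; simp)+

lemma van_der_corput_range: "0 \<le> van_der_corput n \<and> van_der_corput n < 1"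
proof (induction n rule: less_induct)
  case (less n)
  show ?case
  proof (cases "n = 0")
    case False
    then show ?thesis using less[of "n div 2"] by (subst (1 2) van_der_corput.simps) auto
  qed (simp add: van_der_corput.simps)
qed

definition count_below :: "(nat \<Rightarrow> real) \<Rightarrow> real \<Rightarrow> nat \<Rightarrow> nat" where
  "count_below u c n = card {i. i < n \<and> u i < c}"

lemma count_below_0: "count_below u c 0 = 0"
  by (simp add: count_below_def)

lemma count_below_Suc: "count_below u c (Suc n) = count_below u c n + (if u n < c then 1 else 0)"
proof -
  have "{i. i < Suc n \<and> u i < c} = (if u n < c then insert n {i. i < n \<and> u i < c} else {i. i < n \<and> u i < c})"
    by (auto simp: less_Suc_eq)
  then show ?thesis by (simp add: count_below_def)
qed

text \<open>By the doubling formulas, the term with index 2i is below \<open>c\<close> iff the i-th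
  term is below 2c, and the term with index 2i+1 is below \<open>c\<close> iff the i-th term is
  below 2c-1.\<close>

lemma count_below_van_der_corput_double:
  "count_below van_der_corput c (2 * n) =
     count_below van_der_corput (2 * c) n + count_below van_der_corput (2 * c - 1) n"
proof (induction n)
  case (Suc n)
  have "count_below van_der_corput c (2 * Suc n) = count_below van_der_corput c (2 * n)
      + (if van_der_corput (2 * n) < c then 1 else 0) + (if van_der_corput (2 * n + 1) < c then 1 else 0)"
    by (simp add: count_below_Suc)
  then show ?case unfolding Suc.IH van_der_corput_double
    by (simp add: count_below_Suc field_simps)
qed (simp add: count_below_0)

lemma count_below_all: "(\<And>i. u i < c) \<Longrightarrow> count_below u c n = n"
  by (simp add: count_below_def)

lemma count_below_none: "(\<And>i. c \<le> u i) \<Longrightarrow> count_below u c n = 0"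
  by (simp add: count_below_def not_less[symmetric])

text \<open>In the doubling formula one of the two counts is always trivial: it is 0 if 2c is at
  most 1, and \<open>m\<close> otherwise. Hence the error at \<open>n\<close> exceeds that at
  \<open>n div 2\<close> by at most 1. The square root is a convenient bound that this recursion
  preserves.\<close>

lemma van_der_corput_discrepancy:
  assumes "0 \<le> c" "c \<le> 1"
  shows "\<bar>real (count_below van_der_corput c n) - c * real n\<bar> \<le> 4 * sqrt (real n)"
  using assms
proof (induction n arbitrary: c rule: less_induct)
  case (less n)
  show ?case
  proof (cases "n = 0")
    case False
    define m where "m = n div 2"
    have m: "m < n" using False by (simp add: m_def)
    have dbl: "\<bar>real (count_below van_der_corput c (2 * m)) - c * real (2 * m)\<bar> \<le> 4 * sqrt (real m)"
    proof (cases "2 * c \<le> 1")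
      case True
      have "count_below van_der_corput (2 * c - 1) m = 0"
        using True van_der_corput_range by (intro count_below_none) (smt (verit))
      then show ?thesis
        using less.IH[OF m, of "2 * c"] True less.prems
        unfolding count_below_van_der_corput_double by (simp add: algebra_simps)
    next
      case c: False
      have "count_below van_der_corput (2 * c) m = m"
        using c van_der_corput_range by (intro count_below_all) (smt (verit))
      then show ?thesis
        using less.IH[OF m, of "2 * c - 1"] c less.prems
        unfolding count_below_van_der_corput_double by (simp add: algebra_simps)
    qed
    have "\<bar>real (count_below van_der_corput c n) - c * real n\<bar> \<le> 4 * sqrt (real m) + 1"
    proof (cases "even n")
      case True
      then have "n = 2 * m" by (simp add: m_def)
      then show ?thesis using dbl by simp
    next
      case odd: False
      then have "n = Suc (2 * m)" by (simp add: m_def)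
      then have "real (count_below van_der_corput c n) - c * real n =
          (real (count_below van_der_corput c (2 * m)) - c * real (2 * m)) + (if van_der_corput (2 * m) < c then 1 - c else - c)"
        by (simp add: count_below_Suc algebra_simps)
      then show ?thesis using dbl less.prems by (smt (verit))
    qed
    \<comment> \<open>As 1/2 is below 9/16, halving \<open>n\<close> lowers the bound by at least
      \<open>sqrt n\<close>, which absorbs the extra 1.\<close>
    also have "\<dots> \<le> 4 * sqrt (real n)"
    proof -
      have "sqrt (real m) \<le> sqrt (real n / 2)" by (simp add: m_def)
      also have "\<dots> \<le> 3/4 * sqrt (real n)"
      proof -
        have "sqrt (real n / 2) \<le> sqrt ((3/4)\<^sup>2 * real n)" by (simp add: power2_eq_square)
        then show ?thesis by (simp add: real_sqrt_mult)
      qed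
      finally have "4 * sqrt (real m) \<le> 3 * sqrt (real n)" by simp
      moreover have "1 \<le> sqrt (real n)" using False by simp
      ultimately show ?thesis by linarith
    qed
    finally show ?thesis .
  qed (simp add: count_below_0)
qed

lemma van_der_corput_equidistributed:
  assumes "0 \<le> c" "c \<le> 1"
  shows "(\<lambda>n. real (count_below van_der_corput c n) / real n) \<longlonglongrightarrow> c"
proof -
  have "(\<lambda>n. real (count_below van_der_corput c n) / real n - c) \<longlonglongrightarrow> 0"
  proof (rule Lim_null_comparison)
    show "(\<lambda>n. 4 * sqrt (real n) / real n) \<longlonglongrightarrow> 0" by real_asymp
    show "\<forall>\<^sub>F n in sequentially. norm (real (count_below van_der_corput c n) / real n - c) \<le> 4 * sqrt (real n) / real n"
      using eventually_gt_at_top[of 0]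
    proof eventually_elim
      case (elim n)
      have "real (count_below van_der_corput c n) / real n - c = (real (count_below van_der_corput c n) - c * real n) / real n"
        using elim by (simp add: field_simps)
      then show ?case using van_der_corput_discrepancy[OF assms, of n]
        by (simp add: divide_right_mono)
    qed
  qed
  then show ?thesis by (simp add: LIM_zero_iff)
qed

section \<open>Sequences with a prescribed distribution function\<close>

text \<open>A generalised inverse of \<open>f\<close>. At a jump or a plateau, \<open>f\<close> at
  the quantile may lie on either side of \<open>u\<close>; this decides on which side of the
  quantile the digit window is put.\<close>

definition quantile :: "(real \<Rightarrow> real) \<Rightarrow> real \<Rightarrow> real" where
  "quantile f u = Sup {z \<in> {0..1}. f z \<le> u}"

section \<open>Quantiles of a distribution function and digit windows beside them\<close>

context
  fixes f :: "real \<Rightarrow> real"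
  assumes adf: "is_adf f"
begin

lemma adf_mono: "0 \<le> x \<Longrightarrow> x \<le> y \<Longrightarrow> y \<le> 1 \<Longrightarrow> f x \<le> f y"
  using adf by (auto simp: is_adf_def mono_on_def)

lemma adf_bounds: "0 \<le> x \<Longrightarrow> x \<le> 1 \<Longrightarrow> 0 \<le> f x \<and> f x \<le> 1"
  using adf_mono[of 0 x] adf_mono[of x 1] adf by (auto simp: is_adf_def)

lemma quantile_bounds: "0 \<le> u \<Longrightarrow> 0 \<le> quantile f u \<and> quantile f u \<le> 1"
proof -
  assume "0 \<le> u"
  then have 0: "0 \<in> {z \<in> {0..1}. f z \<le> u}" using adf by (auto simp: is_adf_def)
  have "quantile f u \<le> 1" unfolding quantile_def using 0 by (intro cSup_least) (blast | simp)+
  moreover have "0 \<le> quantile f u" unfolding quantile_def using 0 by (intro cSup_upper) (auto intro: bdd_aboveI[of _ 1])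
  ultimately show ?thesis by simp
qed

text \<open>The point \<open>z\<close> lies strictly to the right of \<open>x\<close>, so that
  \<open>u\<close> can be compared with the right limit of \<open>f\<close> at
  \<open>x\<close>.\<close>

lemma adf_le_of_less_quantile:
  assumes "0 \<le> u" "0 \<le> x" "x < quantile f u"
  shows "\<exists>z. x < z \<and> z \<le> 1 \<and> f z \<le> u"
proof -
  have "0 \<in> {z \<in> {0..1}. f z \<le> u}" using adf assms by (auto simp: is_adf_def)
  then obtain z where "z \<in> {z \<in> {0..1}. f z \<le> u}" "x < z"
    using less_cSupD[of "{z \<in> {0..1}. f z \<le> u}" x] assms(3) unfolding quantile_def by blast
  then show ?thesis by auto
qed

lemma adf_gt_of_quantile_less:
  assumes "quantile f u < x" "0 \<le> x" "x \<le> 1"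
  shows "u < f x"
proof (rule ccontr)
  assume "\<not> u < f x"
  then have "x \<le> quantile f u" unfolding quantile_def using assms by (intro cSup_upper) (auto intro: bdd_aboveI[of _ 1])
  then show False using assms by simp
qed

text \<open>\<open>T < y\<close> should hold exactly if \<open>u < f y\<close>, so the window goes
  to the left of \<open>y\<close> in that case and otherwise starts at or after \<open>y\<close>.
  Near the endpoints of [0,1] there may be no room for this; the window is then pushed to the end
  and no side is promised. The value of \<open>\<delta>\<close> is the window length plus one digit
  for rounding.\<close>

lemma digit_window_near_quantile:
  fixes q M :: nat
  assumes "M < q" "0 \<le> u" "u < 1"
  defines "y \<equiv> quantile f u" and "\<delta> \<equiv> (real M + 1) / real q"
  shows "\<exists>a. a + M < q \<and> (\<forall>T. real a / real q \<le> T \<and> T \<le> real (a + M) / real q \<longrightarrow>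
    \<bar>T - y\<bar> \<le> \<delta> \<and> (f y \<le> u \<longrightarrow> y + \<delta> \<le> 1 \<longrightarrow> y \<le> T) \<and> (u < f y \<longrightarrow> \<delta> \<le> y \<longrightarrow> T < y))"
proof -
  have y: "0 \<le> y" "y \<le> 1" using quantile_bounds[OF assms(2)] by (auto simp: y_def)
  have q: "0 < real q" using assms(1) by simp
  have \<delta>q: "\<delta> * real q = real M + 1" using q by (simp add: \<delta>_def)
  define Y where "Y = y * real q"
  define k where "k = nat \<lceil>Y\<rceil>"
  have Y: "0 \<le> Y" "Y \<le> real q" using y q by (auto simp: Y_def mult_left_le_one_le)
  have k: "Y \<le> real k" "real k < Y + 1" "k \<le> q"
    using Y unfolding k_def by linarith+
  have "\<exists>a. a + M < q \<and> (\<forall>t. real a \<le> t \<and> t \<le> real (a + M) \<longrightarrow>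
    \<bar>t - Y\<bar> \<le> real M + 1 \<and> (f y \<le> u \<longrightarrow> Y + real M + 1 \<le> real q \<longrightarrow> Y \<le> t) \<and>
    (u < f y \<longrightarrow> real M + 1 \<le> Y \<longrightarrow> t < Y))"
  proof -
    \<comment> \<open>Right side with room, right side cut off at 1, left side with room, left side
      cut off at 0. In the second and fourth case the side condition is vacuous.\<close>
    consider "f y \<le> u" "k + M + 1 \<le> q" | "f y \<le> u" "q < k + M + 1" | "u < f y" "M + 1 \<le> k" | "u < f y" "k \<le> M"
      by linarith
    then show ?thesis
    proof cases
      case 1
      then show ?thesis using k Y by (intro exI[of _ k]) auto
    next
      case 2
      then have "real (q - M - 1) = real q - real M - 1" "real q < real k + real M + 1"
        using assms(1) by linarith+
      then show ?thesis using k Y 2 assms(1) by (intro exI[of _ "q - M - 1"]) auto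
    next
      case 3
      then have "real (k - M - 1) = real k - real M - 1" by linarith
      then show ?thesis using k Y 3 assms(1) by (intro exI[of _ "k - M - 1"]) auto
    next
      case 4
      then have "real k \<le> real M" by linarith
      then show ?thesis using k Y 4 assms(1) by (intro exI[of _ 0]) auto
    qed
  qed
  then obtain a where a: "a + M < q" and window: "\<And>t. real a \<le> t \<Longrightarrow> t \<le> real (a + M) \<Longrightarrow>
    \<bar>t - Y\<bar> \<le> real M + 1 \<and> (f y \<le> u \<longrightarrow> Y + real M + 1 \<le> real q \<longrightarrow> Y \<le> t) \<and>
    (u < f y \<longrightarrow> real M + 1 \<le> Y \<longrightarrow> t < Y)" by blast
  show ?thesis
  proof (intro exI[of _ a] conjI a allI impI; elim conjE)
    fix T assume T: "real a / real q \<le> T" "T \<le> real (a + M) / real q"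
    then have "real a \<le> T * real q" "T * real q \<le> real (a + M)" using q by (simp_all add: field_simps)
    note w = window[OF this]
    have "\<bar>T - y\<bar> * real q = \<bar>T * real q - Y\<bar>"
      using q by (simp add: Y_def abs_mult_pos left_diff_distrib)
    with w have "\<bar>T - y\<bar> * real q \<le> real M + 1" by simp
    then show "\<bar>T - y\<bar> \<le> \<delta>"
      using q unfolding \<delta>_def by (simp add: pos_le_divide_eq)
    show "y \<le> T" if "f y \<le> u" "y + \<delta> \<le> 1"
    proof -
      have "(y + \<delta>) * real q \<le> 1 * real q" using that q by (intro mult_right_mono) auto
      then have "Y + real M + 1 \<le> real q" using \<delta>q by (simp add: Y_def distrib_right)
      then show ?thesis using w that q by (simp add: Y_def)
    qed
    show "T < y" if "u < f y" "\<delta> \<le> y"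
    proof -
      have "\<delta> * real q \<le> y * real q" using that q by (intro mult_right_mono) auto
      then have "real M + 1 \<le> Y" using \<delta>q by (simp add: Y_def)
      then show ?thesis using w that q by (simp add: Y_def)
    qed
  qed
qed

text \<open>The indices in question are those that \<open>u i < f x\<close> counts but
  \<open>T i < x\<close> misses. Their quantile lies to the left of \<open>x\<close> and, since
  \<open>T i\<close> is close to it, eventually to the right of any \<open>z0 < x\<close>. This
  confines \<open>u i\<close> between \<open>f z0\<close> and the left limit of \<open>f\<close> at
  \<open>x\<close>, which differ by less than \<open>\<epsilon>\<close> for suitable
  \<open>z0\<close>.\<close>

lemma quantile_bad_below:
  fixes u \<delta> T :: "nat \<Rightarrow> real"
  assumes u: "\<And>i. 0 \<le> u i" and x: "0 < x" "x \<le> 1" and \<epsilon>: "0 < \<epsilon>" and \<delta>: "\<delta> \<longlonglongrightarrow> 0"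
    and T: "\<And>i. \<bar>T i - quantile f (u i)\<bar> \<le> \<delta> i"
    and left: "\<And>i. u i < f (quantile f (u i)) \<Longrightarrow> \<delta> i \<le> quantile f (u i) \<Longrightarrow> T i < quantile f (u i)"
  shows "\<exists>\<alpha> \<beta>. 0 \<le> \<alpha> \<and> \<alpha> \<le> \<beta> \<and> \<beta> \<le> 1 \<and> \<beta> - \<alpha> \<le> \<epsilon> \<and>
    (\<forall>\<^sub>F i in sequentially. u i < f x \<longrightarrow> x \<le> T i \<longrightarrow> \<alpha> \<le> u i \<and> u i < \<beta>)"
proof -
  \<comment> \<open>The left limit of \<open>f\<close> at \<open>x\<close>.\<close>
  define S where "S = Sup (f ` {0..<x})"
  have bdd: "bdd_above (f ` {0..<x})" using adf_bounds x by (auto intro!: bdd_aboveI[of _ 1])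
  have ne: "f ` {0..<x} \<noteq> {}" using x by auto
  have S_upper: "f z \<le> S" if "0 \<le> z" "z < x" for z
    unfolding S_def using that bdd by (intro cSup_upper) auto
  obtain z0 where z0: "0 \<le> z0" "z0 < x" "S - \<epsilon> < f z0"
    using less_cSupD[OF ne, of "S - \<epsilon>"] \<epsilon> unfolding S_def by auto
  have S1: "S \<le> 1" unfolding S_def using ne adf_bounds x by (intro cSup_least) auto
  have "\<forall>\<^sub>F i in sequentially. \<delta> i < x - z0" using \<delta> z0 by (intro order_tendstoD) auto
  then have "\<forall>\<^sub>F i in sequentially. u i < f x \<longrightarrow> x \<le> T i \<longrightarrow> f z0 \<le> u i \<and> u i < S"
  proof eventually_elim
    case (elim i)
    show ?case
    proof (intro impI)
      assume ux: "u i < f x" and xT: "x \<le> T i"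
      let ?y = "quantile f (u i)"
      have "?y \<le> x"
      proof (rule ccontr)
        assume "\<not> ?y \<le> x"
        then obtain z where "x < z" "z \<le> 1" "f z \<le> u i"
          using adf_le_of_less_quantile[of "u i" x] u x by auto
        then show False using adf_mono[of x z] x ux by linarith
      qed
      \<comment> \<open>If the quantile were \<open>x\<close> itself, the side rule would give
        \<open>T i < x\<close>; there is room for it because
        \<open>\<delta> i < x - z0 \<le> x\<close>.\<close>
      moreover have "?y \<noteq> x"
        using left[of i] ux xT elim z0 by auto
      ultimately have y: "?y < x" by simp
      have "z0 < ?y" using T[of i] xT elim by linarith
      then obtain z where "z0 < z" "z \<le> 1" "f z \<le> u i"
        using adf_le_of_less_quantile[of "u i" z0] u z0 by auto
      then have "f z0 \<le> u i" using adf_mono[of z0 z] z0 by linarith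
      \<comment> \<open>The midpoint lies strictly between the quantile and \<open>x\<close>: far
        enough right for \<open>f\<close> to exceed \<open>u i\<close>, far enough left for its
        value to be at most \<open>S\<close>.\<close>
      moreover have "u i < f ((?y + x) / 2)"
        using y x quantile_bounds[OF u, of i] by (intro adf_gt_of_quantile_less) auto
      moreover have "f ((?y + x) / 2) \<le> S"
        using y x quantile_bounds[OF u, of i] by (intro S_upper) auto
      ultimately show "f z0 \<le> u i \<and> u i < S" by linarith
    qed
  qed
  moreover have "0 \<le> f z0" using adf_bounds z0 x by simp
  ultimately show ?thesis using S1 z0 S_upper[of z0]
    by (intro exI[of _ "f z0"] exI[of _ S]) auto
qed

text \<open>The mirror image, for indices that \<open>T i < x\<close> counts but
  \<open>u i < f x\<close> does not: their quantile lies to the right of \<open>x\<close>, and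
  \<open>u i\<close> is trapped between the right limit \<open>I\<close> of \<open>f\<close> at
  \<open>x\<close> and a nearby value \<open>f z0\<close>.\<close>

lemma quantile_bad_above:
  fixes u \<delta> T :: "nat \<Rightarrow> real"
  assumes u: "\<And>i. 0 \<le> u i" and x: "0 \<le> x" "x < 1" and \<epsilon>: "0 < \<epsilon>" and \<delta>: "\<delta> \<longlonglongrightarrow> 0"
    and T: "\<And>i. \<bar>T i - quantile f (u i)\<bar> \<le> \<delta> i"
    and right: "\<And>i. f (quantile f (u i)) \<le> u i \<Longrightarrow> quantile f (u i) + \<delta> i \<le> 1 \<Longrightarrow> quantile f (u i) \<le> T i"
  shows "\<exists>\<alpha> \<beta>. 0 \<le> \<alpha> \<and> \<alpha> \<le> \<beta> \<and> \<beta> \<le> 1 \<and> \<beta> - \<alpha> \<le> \<epsilon> \<and>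
    (\<forall>\<^sub>F i in sequentially. f x \<le> u i \<longrightarrow> T i < x \<longrightarrow> \<alpha> \<le> u i \<and> u i < \<beta>)"
proof -
  define I where "I = Inf (f ` {x<..1})"
  have bdd: "bdd_below (f ` {x<..1})" using adf_bounds x by (auto intro!: bdd_belowI[of _ 0])
  have ne: "f ` {x<..1} \<noteq> {}" using x by auto
  have I_lower: "I \<le> f z" if "x < z" "z \<le> 1" for z
    unfolding I_def using that bdd by (intro cInf_lower) auto
  obtain z0 where z0: "x < z0" "z0 \<le> 1" "f z0 < I + \<epsilon>"
    using cInf_lessD[OF ne, of "I + \<epsilon>"] \<epsilon> unfolding I_def by auto
  have I0: "0 \<le> I" unfolding I_def using ne adf_bounds x by (intro cInf_greatest) auto
  have "\<forall>\<^sub>F i in sequentially. \<delta> i < z0 - x" using \<delta> z0 by (intro order_tendstoD) auto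
  then have "\<forall>\<^sub>F i in sequentially. f x \<le> u i \<longrightarrow> T i < x \<longrightarrow> I \<le> u i \<and> u i < f z0"
  proof eventually_elim
    case (elim i)
    show ?case
    proof (intro impI)
      assume ux: "f x \<le> u i" and xT: "T i < x"
      let ?y = "quantile f (u i)"
      have "x \<le> ?y"
        using adf_gt_of_quantile_less[of "u i" x] ux x by force
      moreover have "?y \<noteq> x"
        using right[of i] ux xT elim z0 by auto
      ultimately have y: "x < ?y" by simp
      have "?y < z0" using T[of i] xT elim by linarith
      then have "u i < f z0" using z0 x by (intro adf_gt_of_quantile_less) auto
      moreover obtain z where "x < z" "z \<le> 1" "f z \<le> u i"
        using adf_le_of_less_quantile[of "u i" x] u x y by auto
      then have "I \<le> u i" using I_lower[of z] by linarith
      ultimately show "I \<le> u i \<and> u i < f z0" by linarith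
    qed
  qed
  moreover have "f z0 \<le> 1" using adf_bounds z0 x by simp
  ultimately show ?thesis using I0 z0 I_lower[of z0]
    by (intro exI[of _ I] exI[of _ "f z0"]) auto
qed

end

text \<open>The two counts differ only at indices where exactly one of \<open>T i < x\<close> and
  \<open>u i < c\<close> holds. Such an index is below \<open>m\<close> or has \<open>u i\<close> in
  one of the two intervals. The term \<open>min n m\<close> grows by one per early index, which lets
  the induction compare increments.\<close>

lemma count_below_diff_le:
  fixes u T :: "nat \<Rightarrow> real"
  assumes "\<alpha> \<le> \<beta>" "\<alpha>' \<le> \<beta>'"
    and "\<And>i. m \<le> i \<Longrightarrow> u i < c \<Longrightarrow> x \<le> T i \<Longrightarrow> \<alpha> \<le> u i \<and> u i < \<beta>"
    and "\<And>i. m \<le> i \<Longrightarrow> c \<le> u i \<Longrightarrow> T i < x \<Longrightarrow> \<alpha>' \<le> u i \<and> u i < \<beta>'"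
  shows "\<bar>real (count_below T x n) - real (count_below u c n)\<bar> \<le> real (min n m) +
    (real (count_below u \<beta> n) - real (count_below u \<alpha> n)) +
    (real (count_below u \<beta>' n) - real (count_below u \<alpha>' n))"
proof (induction n)
  case 0
  show ?case by (simp add: count_below_0)
next
  case (Suc n)
  define g where "g d = (if u n < d then 1 else 0 :: real)" for d
  define gT where "gT = (if T n < x then 1 else 0 :: real)"
  have u_Suc: "real (count_below u d (Suc n)) = real (count_below u d n) + g d" for d
    by (simp add: count_below_Suc g_def)
  have T_Suc: "real (count_below T x (Suc n)) = real (count_below T x n) + gT"
    by (simp add: count_below_Suc gT_def)
  have "\<bar>gT - g c\<bar> \<le> (real (min (Suc n) m) - real (min n m)) + (g \<beta> - g \<alpha>) + (g \<beta>' - g \<alpha>')"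
  proof (cases "n < m")
    case True
    then have "real (min (Suc n) m) - real (min n m) = 1" by simp
    then show ?thesis using assms(1,2) by (auto simp: gT_def g_def)
  next
    case False
    then have "real (min (Suc n) m) - real (min n m) = 0" by simp
    then show ?thesis using assms(1,2) assms(3)[of n] assms(4)[of n] False by (auto simp: gT_def g_def)
  qed
  then show ?case using Suc.IH unfolding u_Suc T_Suc by linarith
qed

text \<open>By equidistribution \<open>u i < f x\<close> holds with frequency \<open>f x\<close>.
  Replacing this condition by \<open>T i < x\<close> changes the frequency by at most the total
  length of two arbitrarily short intervals, up to a term tending to 0.\<close>

lemma has_adf_near_quantiles:
  fixes T \<delta> :: "nat \<Rightarrow> real"
  assumes adf: "is_adf f" and \<delta>: "\<delta> \<longlonglongrightarrow> 0" and T0: "\<And>i. 0 \<le> T i"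
    and T: "\<And>i. \<bar>T i - quantile f (van_der_corput i)\<bar> \<le> \<delta> i"
    and right: "\<And>i. f (quantile f (van_der_corput i)) \<le> van_der_corput i \<Longrightarrow>
      quantile f (van_der_corput i) + \<delta> i \<le> 1 \<Longrightarrow> quantile f (van_der_corput i) \<le> T i"
    and left: "\<And>i. van_der_corput i < f (quantile f (van_der_corput i)) \<Longrightarrow>
      \<delta> i \<le> quantile f (van_der_corput i) \<Longrightarrow> T i < quantile f (van_der_corput i)"
  shows "has_adf T f"
  unfolding has_adf_def
proof
  fix x :: real assume x: "x \<in> {0..1}"
  let ?u = van_der_corput
  have u: "0 \<le> ?u i" "?u i < 1" for i using van_der_corput_range[of i] by auto
  have fx: "0 \<le> f x" "f x \<le> 1" using adf_bounds[OF adf, of x] x by auto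
  have eq: "{i. i < n \<and> T i \<in> {0..<x}} = {i. i < n \<and> T i < x}" for n using T0 by auto
  have "(\<lambda>n. real (count_below T x n) / real n - real (count_below ?u (f x) n) / real n) \<longlonglongrightarrow> 0"
  proof (rule tendstoI)
    fix e :: real assume "0 < e"
    \<comment> \<open>Two intervals of length at most e/4 leave a strict margin below
      \<open>e\<close>.\<close>
    define \<epsilon> where "\<epsilon> = e / 4"
    have \<epsilon>: "0 < \<epsilon>" using \<open>0 < e\<close> by (simp add: \<epsilon>_def)
    have "\<exists>\<alpha> \<beta>. 0 \<le> \<alpha> \<and> \<alpha> \<le> \<beta> \<and> \<beta> \<le> 1 \<and> \<beta> - \<alpha> \<le> \<epsilon> \<and>
      (\<forall>\<^sub>F i in sequentially. ?u i < f x \<longrightarrow> x \<le> T i \<longrightarrow> \<alpha> \<le> ?u i \<and> ?u i < \<beta>)"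
    \<comment> \<open>At \<open>x = 0\<close> there is no left limit, but
      \<open>u i < f 0 = 0\<close> never happens; likewise \<open>f 1 = 1 \<le> u i\<close> never
      happens at \<open>x = 1\<close>.\<close>
    proof (cases "x = 0")
      case True
      then have "\<not> ?u i < f x" for i using adf u(1)[of i] by (auto simp: is_adf_def)
      then show ?thesis using \<epsilon> by (intro exI[of _ 0]) auto
    next
      case False
      then show ?thesis using x by (intro quantile_bad_below[OF adf u(1) _ _ \<epsilon> \<delta> T left]) auto
    qed
    then obtain \<alpha> \<beta> where \<alpha>\<beta>: "0 \<le> \<alpha>" "\<alpha> \<le> \<beta>" "\<beta> \<le> 1" "\<beta> - \<alpha> \<le> \<epsilon>"
      and ev: "\<forall>\<^sub>F i in sequentially. ?u i < f x \<longrightarrow> x \<le> T i \<longrightarrow> \<alpha> \<le> ?u i \<and> ?u i < \<beta>" by blast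
    have "\<exists>\<alpha> \<beta>. 0 \<le> \<alpha> \<and> \<alpha> \<le> \<beta> \<and> \<beta> \<le> 1 \<and> \<beta> - \<alpha> \<le> \<epsilon> \<and>
      (\<forall>\<^sub>F i in sequentially. f x \<le> ?u i \<longrightarrow> T i < x \<longrightarrow> \<alpha> \<le> ?u i \<and> ?u i < \<beta>)"
    proof (cases "x = 1")
      case True
      then have "\<not> f x \<le> ?u i" for i using adf u(2)[of i] by (auto simp: is_adf_def)
      then show ?thesis using \<epsilon> by (intro exI[of _ 0]) auto
    next
      case False
      then show ?thesis using x by (intro quantile_bad_above[OF adf u(1) _ _ \<epsilon> \<delta> T right]) auto
    qed
    then obtain \<alpha>' \<beta>' where \<alpha>\<beta>': "0 \<le> \<alpha>'" "\<alpha>' \<le> \<beta>'" "\<beta>' \<le> 1" "\<beta>' - \<alpha>' \<le> \<epsilon>"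
      and ev': "\<forall>\<^sub>F i in sequentially. f x \<le> ?u i \<longrightarrow> T i < x \<longrightarrow> \<alpha>' \<le> ?u i \<and> ?u i < \<beta>'" by blast
    obtain m where m: "\<And>i. m \<le> i \<Longrightarrow> ?u i < f x \<Longrightarrow> x \<le> T i \<Longrightarrow> \<alpha> \<le> ?u i \<and> ?u i < \<beta>"
      "\<And>i. m \<le> i \<Longrightarrow> f x \<le> ?u i \<Longrightarrow> T i < x \<Longrightarrow> \<alpha>' \<le> ?u i \<and> ?u i < \<beta>'"
      using eventually_conj[OF ev ev'] unfolding eventually_sequentially by blast
    define F where "F c n = real (count_below ?u c n) / real n" for c n
    have F: "F c \<longlonglongrightarrow> c" if "0 \<le> c" "c \<le> 1" for c
      unfolding F_def using van_der_corput_equidistributed[OF that] .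
    have "(\<lambda>n. real m / real n + (F \<beta> n - F \<alpha> n) + (F \<beta>' n - F \<alpha>' n)) \<longlonglongrightarrow> 0 + (\<beta> - \<alpha>) + (\<beta>' - \<alpha>')"
      using \<alpha>\<beta> \<alpha>\<beta>' by (intro tendsto_add tendsto_diff F lim_const_over_n) auto
    moreover have "0 + (\<beta> - \<alpha>) + (\<beta>' - \<alpha>') < e"
      using \<alpha>\<beta>(4) \<alpha>\<beta>'(4) \<open>0 < e\<close> unfolding \<epsilon>_def by linarith
    ultimately have "\<forall>\<^sub>F n in sequentially. real m / real n + (F \<beta> n - F \<alpha> n) + (F \<beta>' n - F \<alpha>' n) < e"
      by (rule order_tendstoD)
    then show "\<forall>\<^sub>F n in sequentially. dist (real (count_below T x n) / real n - real (count_below ?u (f x) n) / real n) 0 < e"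
      using eventually_gt_at_top[of 0]
    proof eventually_elim
      case (elim n)
      have "\<bar>real (count_below T x n) - real (count_below ?u (f x) n)\<bar> \<le> real (min n m) +
        (real (count_below ?u \<beta> n) - real (count_below ?u \<alpha> n)) +
        (real (count_below ?u \<beta>' n) - real (count_below ?u \<alpha>' n))"
        by (rule count_below_diff_le) (use \<alpha>\<beta> \<alpha>\<beta>' m in auto)
      then have "\<bar>real (count_below T x n) - real (count_below ?u (f x) n)\<bar> \<le> real m +
        (real (count_below ?u \<beta> n) - real (count_below ?u \<alpha> n)) +
        (real (count_below ?u \<beta>' n) - real (count_below ?u \<alpha>' n))" by linarith
      then have "\<bar>real (count_below T x n) - real (count_below ?u (f x) n)\<bar> / real n \<le> (real m +
        (real (count_below ?u \<beta> n) - real (count_below ?u \<alpha> n)) +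
        (real (count_below ?u \<beta>' n) - real (count_below ?u \<alpha>' n))) / real n"
        by (rule divide_right_mono) simp
      also have "\<dots> < e" using elim by (simp add: F_def add_divide_distrib diff_divide_distrib)
      finally show ?case by (simp add: dist_real_def diff_divide_distrib[symmetric])
    qed
  qed
  from tendsto_add[OF this van_der_corput_equidistributed[OF fx]]
  have "(\<lambda>n. real (count_below T x n) / real n) \<longlonglongrightarrow> f x" by simp
  then show "(\<lambda>n. real (card {i. i < n \<and> T i \<in> {0..<x}}) / real n) \<longlonglongrightarrow> f x"
    by (simp only: eq count_below_def)
qed

text \<open>The windows are fixed before \<open>T\<close>, so one choice of \<open>a\<close> serves
  all points built from these digits.\<close>

lemma digit_windows_for_adf:
  fixes q M :: "nat \<Rightarrow> nat"
  assumes adf: "is_adf f" and Mq: "\<And>n. M n < q n"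
    and lim: "(\<lambda>n. (real (M n) + 1) / real (q n)) \<longlonglongrightarrow> 0"
  shows "\<exists>a. (\<forall>n. a n + M n < q n) \<and>
    (\<forall>T. (\<forall>n. real (a n) / real (q n) \<le> T n \<and> T n \<le> real (a n + M n) / real (q n)) \<longrightarrow> has_adf T f)"
proof -
  let ?y = "\<lambda>n. quantile f (van_der_corput n)" and ?\<delta> = "\<lambda>n. (real (M n) + 1) / real (q n)"
  have "\<forall>n. \<exists>a. a + M n < q n \<and> (\<forall>t. real a / real (q n) \<le> t \<and> t \<le> real (a + M n) / real (q n) \<longrightarrow>
    \<bar>t - ?y n\<bar> \<le> ?\<delta> n \<and> (f (?y n) \<le> van_der_corput n \<longrightarrow> ?y n + ?\<delta> n \<le> 1 \<longrightarrow> ?y n \<le> t) \<and>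
    (van_der_corput n < f (?y n) \<longrightarrow> ?\<delta> n \<le> ?y n \<longrightarrow> t < ?y n))"
    using digit_window_near_quantile[OF adf Mq] van_der_corput_range by simp
  from choice[OF this] obtain a where a: "\<And>n. a n + M n < q n"
    and window: "\<And>n t. real (a n) / real (q n) \<le> t \<Longrightarrow> t \<le> real (a n + M n) / real (q n) \<Longrightarrow>
    \<bar>t - ?y n\<bar> \<le> ?\<delta> n \<and> (f (?y n) \<le> van_der_corput n \<longrightarrow> ?y n + ?\<delta> n \<le> 1 \<longrightarrow> ?y n \<le> t) \<and>
    (van_der_corput n < f (?y n) \<longrightarrow> ?\<delta> n \<le> ?y n \<longrightarrow> t < ?y n)"
    by blast
  show ?thesis
  proof (intro exI[of _ a] conjI allI impI a)
    fix T :: "nat \<Rightarrow> real"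
    assume T: "\<forall>n. real (a n) / real (q n) \<le> T n \<and> T n \<le> real (a n + M n) / real (q n)"
    have "0 \<le> T n" for n using T by (meson divide_nonneg_nonneg of_nat_0_le_iff order_trans)
    moreover note w = window[OF T[rule_format, THEN conjunct1] T[rule_format, THEN conjunct2]]
    ultimately show "has_adf T f"
      by (intro has_adf_near_quantiles[OF adf lim]) auto
  qed
qed

section \<open>Cantor series with restricted digits\<close>

text \<open>The number with Cantor digits \<open>e n\<close>, \<open>e (n + 1)\<close>, ... for the
  bases \<open>q n\<close>, \<open>q (n + 1)\<close>, ...; index 0 gives the full number, larger
  indices its tails.\<close>

definition cantor_series :: "(nat \<Rightarrow> nat) \<Rightarrow> (nat \<Rightarrow> nat) \<Rightarrow> nat \<Rightarrow> real" where
  "cantor_series q e n = (\<Sum>k. real (e (n + k)) / real (\<Prod>i\<le>k. q (n + i)))"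

context
  fixes q e :: "nat \<Rightarrow> nat"
  assumes digit: "\<And>n. e n < q n"
begin

text \<open>For the maximal digits \<open>q k - 1\<close> the sum telescopes to exactly the
  right-hand side.\<close>

lemma cantor_series_partial_le:
  "(\<Sum>k<m. real (e (n + k)) / real (\<Prod>i\<le>k. q (n + i))) \<le> 1 - 1 / real (\<Prod>i<m. q (n + i))"
proof (induction m)
  case (Suc m)
  have q: "0 < q k" for k using digit[of k] by simp
  define p where "p = real (\<Prod>i<m. q (n + i))"
  have p: "0 < p" using q by (simp add: p_def prod_pos)
  have pq: "real (\<Prod>i\<le>m. q (n + i)) = p * real (q (n + m))"
    by (simp add: p_def lessThan_Suc_atMost[symmetric])
  have "real (e (n + m)) \<le> real (q (n + m)) - 1" using digit[of "n + m"] by linarith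
  then have "real (e (n + m)) / (p * real (q (n + m))) \<le> (real (q (n + m)) - 1) / (p * real (q (n + m)))"
    using p by (intro divide_right_mono) auto
  also have "\<dots> = 1 / p - 1 / (p * real (q (n + m)))"
    using p q[of "n + m"] by (simp add: field_simps)
  finally have "real (e (n + m)) / (p * real (q (n + m))) \<le> 1 / p - 1 / (p * real (q (n + m)))" .
  then show ?case using Suc.IH unfolding sum.lessThan_Suc pq by (simp add: p_def)
qed simp

lemma cantor_series_partial_le_1:
  "(\<Sum>k<m. real (e (n + k)) / real (\<Prod>i\<le>k. q (n + i))) \<le> 1"
proof -
  have "0 \<le> 1 / real (\<Prod>i<m. q (n + i))" by (simp add: prod_nonneg)
  then show ?thesis using cantor_series_partial_le[of n m] by linarith
qed

lemma cantor_series_summable: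
  "summable (\<lambda>k. real (e (n + k)) / real (\<Prod>i\<le>k. q (n + i)))"
  by (rule summableI_nonneg_bounded[OF _ cantor_series_partial_le_1]) (simp add: prod_nonneg)

lemma cantor_series_bounds: "0 \<le> cantor_series q e n" "cantor_series q e n \<le> 1"
proof -
  show "0 \<le> cantor_series q e n"
    unfolding cantor_series_def by (intro suminf_nonneg cantor_series_summable) (simp add: prod_nonneg)
  show "cantor_series q e n \<le> 1"
    unfolding cantor_series_def by (intro suminf_le_const cantor_series_summable cantor_series_partial_le_1)
qed

lemma cantor_series_step:
  "real (q n) * cantor_series q e n = real (e n) + cantor_series q e (Suc n)"
proof -
  have q: "0 < real (q n)" using digit[of n] by simp
  have "cantor_series q e n = real (e n) / real (q n) +
      (\<Sum>k. real (e (n + Suc k)) / real (\<Prod>i\<le>Suc k. q (n + i)))"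
    unfolding cantor_series_def using suminf_split_head[OF cantor_series_summable[of n]] by simp
  also have "(\<Sum>k. real (e (n + Suc k)) / real (\<Prod>i\<le>Suc k. q (n + i))) =
      (\<Sum>k. 1 / real (q n) * (real (e (Suc n + k)) / real (\<Prod>i\<le>k. q (Suc n + i))))"
    by (simp only: prod.atMost_Suc_shift) simp
  also have "\<dots> = 1 / real (q n) * cantor_series q e (Suc n)"
    unfolding cantor_series_def by (intro suminf_mult cantor_series_summable)
  finally show ?thesis using q by (simp add: field_simps)
qed

text \<open>Multiplication by the first \<open>n\<close> bases turns the first \<open>n\<close>
  digits into an integer and leaves the tail.\<close>

lemma cantor_series_shift:
  "\<exists>z. real (\<Prod>i<n. q i) * cantor_series q e 0 = of_int z + cantor_series q e n"
proof (induction n)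
  case 0
  show ?case by (intro exI[of _ 0]) simp
next
  case (Suc n)
  then obtain z where z: "real (\<Prod>i<n. q i) * cantor_series q e 0 = of_int z + cantor_series q e n" by blast
  have "real (\<Prod>i<Suc n. q i) * cantor_series q e 0 = real (q n) * (real (\<Prod>i<n. q i) * cantor_series q e 0)"
    by simp
  also have "\<dots> = of_int (int (q n) * z + int (e n)) + cantor_series q e (Suc n)"
    unfolding z distrib_left cantor_series_step by simp
  finally show ?case by blast
qed

end

text \<open>\<open>M_half\<close> keeps the tails in windows of length at most 1/2, so that
  different digits separate points; the strict \<open>window\<close> keeps the tails below 1, so
  that they are fractional parts; \<open>M_ge_2\<close> makes the products of the \<open>M n\<close>
  unbounded, so that digits determine \<open>t\<close>.\<close>

locale digit_windows =
  fixes q M a :: "nat \<Rightarrow> nat"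
  assumes M_pos: "0 < M n"
    and M_half: "2 * M n \<le> q n"
    and window: "a n + M n < q n"
    and M_ge_2: "\<forall>\<^sub>F n in sequentially. 2 \<le> M n"
begin

section \<open>The embedding by restricted digits and its inverse Hoelder estimate\<close>

definition tail :: "real \<Rightarrow> nat \<Rightarrow> real" where
  "tail t n = frac (real (\<Prod>i<n. M i) * t)"

definition digit :: "real \<Rightarrow> nat \<Rightarrow> nat" where
  "digit t n = nat \<lfloor>real (M n) * tail t n\<rfloor>"

text \<open>The \<open>n\<close>-th digit ranges over \<open>{a n..<a n + M n}\<close> as the \<open>n\<close>-th Cantor digit of \<open>t\<close> for the bases \<open>M\<close> ranges over \<open>{0..<M n}\<close>.\<close>
definition embed_tail :: "real \<Rightarrow> nat \<Rightarrow> real" where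
  "embed_tail t = cantor_series q (\<lambda>n. a n + digit t n)"

definition embed :: "real \<Rightarrow> real" where
  "embed t = embed_tail t 0"

lemma tail_bounds: "0 \<le> tail t n" "tail t n < 1"
  by (auto simp: tail_def frac_lt_1)

lemma digit_less: "digit t n < M n"
proof -
  have "real (M n) * tail t n < real (M n)" using M_pos[of n] tail_bounds[of t n] by simp
  moreover have "0 \<le> real (M n) * tail t n" using tail_bounds[of t n] by simp
  ultimately show ?thesis unfolding digit_def by linarith
qed

lemma tail_step: "real (M n) * tail t n = real (digit t n) + tail t (Suc n)"
proof -
  define y where "y = real (\<Prod>i<n. M i) * t"
  have 0: "0 \<le> real (M n) * tail t n" using tail_bounds[of t n] by simp
  have "tail t (Suc n) = frac (real (M n) * y)" by (simp add: tail_def y_def mult.assoc mult.left_commute)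
  also have "real (M n) * y = real (M n) * tail t n + of_int (int (M n) * \<lfloor>y\<rfloor>)"
  proof -
    have y: "y = tail t n + of_int \<lfloor>y\<rfloor>" by (simp add: tail_def y_def frac_def)
    show ?thesis by (subst y) (simp add: distrib_left)
  qed
  also have "frac \<dots> = frac (real (M n) * tail t n)" by (simp add: frac_def del: of_int_mult)
  finally show ?thesis using 0 by (simp add: digit_def frac_def)
qed

lemma embed_digit: "a n + digit t n < q n"
  using digit_less[of t n] window[of n] by linarith

lemma embed_tail_step: "real (q n) * embed_tail t n = real (a n + digit t n) + embed_tail t (Suc n)"
  unfolding embed_tail_def by (rule cantor_series_step) (rule embed_digit)

lemma embed_tail_window:
  "real (a n) / real (q n) \<le> embed_tail t n" "embed_tail t n \<le> real (a n + M n) / real (q n)"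
proof -
  have q: "0 < real (q n)" using window[of n] by simp
  have b: "0 \<le> embed_tail t (Suc n)" "embed_tail t (Suc n) \<le> 1"
    unfolding embed_tail_def by (intro cantor_series_bounds embed_digit)+
  have "real (digit t n) + 1 \<le> real (M n)" using digit_less[of t n] by linarith
  then have "real (a n) \<le> real (q n) * embed_tail t n" "real (q n) * embed_tail t n \<le> real (a n + M n)"
    unfolding embed_tail_step using b by simp_all
  then show "real (a n) / real (q n) \<le> embed_tail t n" "embed_tail t n \<le> real (a n + M n) / real (q n)"
    using q by (simp_all add: field_simps)
qed

text \<open>The shifted number is an integer plus the tail, and the tail lies in [0,1) because its
  window ends strictly before 1.\<close>

lemma frac_embed: "frac (real (\<Prod>i<n. q i) * embed t) = embed_tail t n"
proof -
  obtain z where z: "real (\<Prod>i<n. q i) * embed t = of_int z + embed_tail t n"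
    using cantor_series_shift[of "\<lambda>n. a n + digit t n" q n] embed_digit
    unfolding embed_def embed_tail_def by blast
  have "0 \<le> embed_tail t n" unfolding embed_tail_def by (intro cantor_series_bounds embed_digit)
  moreover have "real (a n + M n) / real (q n) < 1" using window[of n] by simp
  then have "embed_tail t n < 1" using embed_tail_window(2)[of t n] by linarith
  ultimately show ?thesis unfolding z by (simp add: frac_unique_iff)
qed

lemma common_digits:
  assumes "\<And>i. i < n \<Longrightarrow> digit t i = digit t' i" and t: "t \<in> {0..<1}" "t' \<in> {0..<1}"
  shows "real (\<Prod>i<n. M i) * (t - t') = tail t n - tail t' n"
    and "real (\<Prod>i<n. q i) * (embed t - embed t') = embed_tail t n - embed_tail t' n"
  using assms(1)
proof (induction n)
  case 0
  have "frac t = t" "frac t' = t'" using t by (auto simp: frac_eq)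
  { case 1 show ?case using \<open>frac t = t\<close> \<open>frac t' = t'\<close> by (simp add: tail_def) }
  { case 2 show ?case by (simp add: embed_def) }
next
  case (Suc n)
  { case 1
    have "real (\<Prod>i<Suc n. M i) * (t - t') = real (M n) * (real (\<Prod>i<n. M i) * (t - t'))" by simp
    also have "\<dots> = real (M n) * (tail t n - tail t' n)" using Suc.IH(1) 1 by simp
    also have "\<dots> = tail t (Suc n) - tail t' (Suc n)" using 1 by (simp add: right_diff_distrib tail_step)
    finally show ?case . }
  { case 2
    have "real (\<Prod>i<Suc n. q i) * (embed t - embed t') = real (q n) * (real (\<Prod>i<n. q i) * (embed t - embed t'))" by simp
    also have "\<dots> = real (q n) * (embed_tail t n - embed_tail t' n)" using Suc.IH(2) 2 by simp
    also have "\<dots> = embed_tail t (Suc n) - embed_tail t' (Suc n)" using 2 by (simp add: right_diff_distrib embed_tail_step)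
    finally show ?case . }
qed

lemma prod_M_unbounded: "\<exists>n. r < real (\<Prod>i<n. M i)"
proof -
  obtain m where m: "\<And>n. m \<le> n \<Longrightarrow> 2 \<le> M n" using M_ge_2 unfolding eventually_sequentially by blast
  have "2 ^ k \<le> (\<Prod>i<m + k. M i)" for k
  proof (induction k)
    case 0
    show ?case using M_pos by (simp add: Suc_le_eq prod_pos)
  next
    case (Suc k)
    then show ?case using mult_mono[OF Suc m[of "m + k"]] by (simp add: mult.commute)
  qed
  then have "2 ^ k \<le> real (\<Prod>i<m + k. M i)" for k
    by (metis of_nat_le_iff of_nat_numeral of_nat_power)
  moreover obtain k where "r < 2 ^ k" using real_arch_pow[of 2 r] by auto
  ultimately show ?thesis by (meson less_le_trans)
qed

text \<open>At the first differing digit, with digit difference \<open>D\<close>, the distance of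
  \<open>t\<close> and \<open>t'\<close> is at most \<open>2 * D / (m * N)\<close>, while that of
  their images is at least \<open>D / (2 * P * b)\<close>. With \<open>D / m\<close> as common
  factor, the growth hypothesis compares the rest.\<close>

lemma embed_inverse_Holder:
  assumes s: "0 < s" "s \<le> 1" and C: "0 < C"
    and growth: "\<And>n. (2 * real (\<Prod>i<n. q i) * (real (q n) / real (M n))) powr s \<le> C * real (\<Prod>i<n. M i)"
    and t: "t \<in> {0..<1}" "t' \<in> {0..<1}"
  shows "\<bar>t - t'\<bar> \<le> 2 * C * dist (embed t) (embed t') powr s"
proof (cases "t = t'")
  case False
  have "\<exists>n. digit t n \<noteq> digit t' n"
  proof (rule ccontr)
    assume "\<not> ?thesis"
    then have eq: "real (\<Prod>i<n. M i) * (t - t') = tail t n - tail t' n" for n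
      using common_digits(1)[OF _ t] by simp
    obtain n where n: "1 / \<bar>t - t'\<bar> < real (\<Prod>i<n. M i)" using prod_M_unbounded by blast
    have "1 < real (\<Prod>i<n. M i) * \<bar>t - t'\<bar>" using n False by (simp add: pos_divide_less_eq)
    also have "\<dots> = \<bar>real (\<Prod>i<n. M i) * (t - t')\<bar>" by (simp only: abs_mult abs_of_nat)
    also have "\<dots> \<le> 1" unfolding eq using tail_bounds[of t n] tail_bounds[of t' n] by linarith
    finally show False by simp
  qed
  define n where "n = (LEAST n. digit t n \<noteq> digit t' n)"
  have ne: "digit t n \<noteq> digit t' n"
    unfolding n_def using \<open>\<exists>n. digit t n \<noteq> digit t' n\<close> by (rule LeastI_ex)
  have same: "digit t i = digit t' i" if "i < n" for i
    using not_less_Least that unfolding n_def by blast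
  define N P D m b where "N = real (\<Prod>i<n. M i)" and "P = real (\<Prod>i<n. q i)"
    and "D = \<bar>real (digit t n) - real (digit t' n)\<bar>" and "m = real (M n)" and "b = real (q n)"
  have pos: "0 < N" "0 < P" "0 < m" "0 < b"
    using M_pos window[THEN gr_implies_not0] by (auto simp: N_def P_def m_def b_def intro!: prod_pos)
  have D: "1 \<le> D" "D \<le> m"
    using ne digit_less[of t n] digit_less[of t' n] unfolding D_def m_def by linarith+
  have "m * (N * \<bar>t - t'\<bar>) = m * \<bar>N * (t - t')\<bar>" using pos by (simp add: abs_mult)
  also have "\<dots> = m * \<bar>tail t n - tail t' n\<bar>" using common_digits(1)[OF same t] by (simp add: N_def)
  also have "\<dots> = \<bar>m * tail t n - m * tail t' n\<bar>" using pos by (simp add: abs_mult flip: right_diff_distrib)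
  also have "\<dots> \<le> D + 1"
    unfolding m_def tail_step D_def using tail_bounds[of t "Suc n"] tail_bounds[of t' "Suc n"] by linarith
  also have "\<dots> \<le> 2 * D" using D by simp
  finally have upper: "\<bar>t - t'\<bar> \<le> 2 * (D / m) / N" using pos by (simp add: field_simps)
  \<comment> \<open>Tails differing by at most 1/2 cannot cancel a digit difference \<open>D\<close>
    of at least 1; at least half of \<open>D\<close> survives.\<close>
  have half: "\<bar>embed_tail t (Suc n) - embed_tail t' (Suc n)\<bar> \<le> 1 / 2"
  proof -
    have "real (a (Suc n) + M (Suc n)) / real (q (Suc n)) - real (a (Suc n)) / real (q (Suc n)) \<le> 1 / 2"
      using M_half[of "Suc n"] window[of "Suc n"] by (simp add: diff_divide_distrib[symmetric] field_simps)
    then show ?thesis using embed_tail_window[where n = "Suc n" and t = t]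
        embed_tail_window[where n = "Suc n" and t = t'] by linarith
  qed
  have "D / 2 \<le> \<bar>b * embed_tail t n - b * embed_tail t' n\<bar>"
  proof -
    have "D \<le> \<bar>b * embed_tail t n - b * embed_tail t' n\<bar> + \<bar>embed_tail t (Suc n) - embed_tail t' (Suc n)\<bar>"
      unfolding b_def embed_tail_step of_nat_add D_def by linarith
    then show ?thesis using half D(1) by linarith
  qed
  also have "\<dots> = b * \<bar>embed_tail t n - embed_tail t' n\<bar>" using pos by (simp add: abs_mult flip: right_diff_distrib)
  also have "\<dots> = b * \<bar>P * (embed t - embed t')\<bar>" using common_digits(2)[OF same t] by (simp add: P_def)
  also have "\<dots> = b * P * dist (embed t) (embed t')" using pos by (simp add: abs_mult dist_real_def)
  finally have lower: "(D / m) / (2 * P * (b / m)) \<le> dist (embed t) (embed t')"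
    using pos by (simp add: field_simps)
  have A: "0 < D / m" "D / m \<le> 1" using D pos by auto
  \<comment> \<open>Normalising by \<open>m\<close> makes the factor at most 1, so raising it to a
    power \<open>s \<le> 1\<close> does not decrease it.\<close>
  have "D / m \<le> (D / m) powr s" using powr_mono'[of s 1 "D / m"] s A D pos by simp
  moreover have "(2 * P * (b / m)) powr s \<le> C * N"
    using growth[of n] by (simp add: P_def N_def b_def m_def)
  moreover have "0 < (2 * P * (b / m)) powr s" using pos by simp
  ultimately have "(D / m) / (C * N) \<le> (D / m) powr s / (2 * P * (b / m)) powr s"
    using A by (intro frac_le) auto
  also have "\<dots> = ((D / m) / (2 * P * (b / m))) powr s" by (simp only: powr_divide)
  also have "\<dots> \<le> dist (embed t) (embed t') powr s" using lower s D pos by (intro powr_mono2) auto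
  finally have "2 * C * ((D / m) / (C * N)) \<le> 2 * C * dist (embed t) (embed t') powr s"
    using C by (intro mult_left_mono) auto
  then show ?thesis using upper C by simp
qed (use C in simp)

end

section \<open>Growth of the digit sets\<close>

text \<open>The quotient \<open>g n / h n\<close> is non-increasing from some index on, so it is
  bounded by the sum of its values up to there.\<close>

lemma eventually_ratio_imp_bound:
  fixes g h :: "nat \<Rightarrow> real"
  assumes "\<And>n. 0 < g n" "\<And>n. 0 < h n"
    and "\<forall>\<^sub>F n in sequentially. g (Suc n) / g n \<le> h (Suc n) / h n"
  shows "\<exists>C>0. \<forall>n. g n \<le> C * h n"
proof -
  obtain m where m: "\<And>n. m \<le> n \<Longrightarrow> g (Suc n) / g n \<le> h (Suc n) / h n"
    using assms(3) unfolding eventually_sequentially by blast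
  define C where "C = (\<Sum>i\<le>m. g i / h i)"
  have small: "g n \<le> C * h n" if "n \<le> m" for n
  proof -
    have "g n / h n \<le> C" unfolding C_def
      using that assms(1,2) by (intro member_le_sum) (auto simp: less_imp_le)
    then show ?thesis using assms(2)[of n] by (simp add: field_simps)
  qed
  have "g n \<le> C * h n" for n
  proof (cases "n \<le> m")
    case False
    then have "m \<le> n" by simp
    then show ?thesis
    proof (induction n rule: dec_induct)
      case (step n)
      have "g (Suc n) = g (Suc n) / g n * g n" using assms(1)[of n] by simp
      also have "\<dots> \<le> h (Suc n) / h n * (C * h n)"
        using m[OF step(1)] step.IH assms(1)[of n] assms(1)[of "Suc n"] assms(2)[of n] assms(2)[of "Suc n"]
        by (intro mult_mono) (auto simp: less_imp_le)
      also have "\<dots> = C * h (Suc n)" using assms(2)[of n] by simp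
      finally show ?case .
    qed (rule small, simp)
  qed (rule small)
  moreover have "0 < C" unfolding C_def using assms(1,2) by (intro sum_pos) auto
  ultimately show ?thesis by blast
qed

text \<open>Rounding costs at most a factor 2, that is \<open>q n \<le> 2 * R n * M n\<close>, so
  the loss from restricting digits is at most \<open>G n\<close>, the product of the
  \<open>2 * R i\<close>. Slow growth of \<open>R\<close> makes this loss smaller than any power of
  \<open>P n\<close>, up to a constant.\<close>

lemma digit_count_growth:
  fixes q R :: "nat \<Rightarrow> nat"
  assumes R: "\<And>n. 2 \<le> R n" "\<And>n. R n \<le> q n" and s: "0 < s" "s < 1"
    and slow: "\<forall>\<^sub>F n in sequentially. 2 * real (R (Suc n)) \<le> real (q n) powr (1 - s)"
  shows "\<exists>C>0. \<forall>n. (2 * real (\<Prod>i<n. q i) * (real (q n) / real (q n div R n))) powr s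
    \<le> C * real (\<Prod>i<n. q i div R i)"
proof -
  define M where "M n = q n div R n" for n
  define P where "P n = real (\<Prod>i<n. q i)" for n
  define G where "G n = (\<Prod>i<n. 2 * real (R i))" for n
  have q: "0 < real (q n)" for n using R[of n] by simp
  have Rpos: "0 < real (R n)" for n using R(1)[of n] by simp
  have P: "0 < P n" for n unfolding P_def using q by (simp add: prod_pos)
  have G: "0 < G n" for n unfolding G_def using Rpos by (simp add: prod_pos)
  have M: "0 < M n" for n unfolding M_def using R[of n] by (simp add: div_greater_zero_iff)
  have ratio: "real (q n) \<le> 2 * real (R n) * real (M n)" for n
  proof -
    have "q n = R n * M n + q n mod R n" unfolding M_def by simp
    also have "\<dots> \<le> R n * M n + R n * M n"
    proof -
      have "q n mod R n \<le> R n" using R(1)[of n] by (simp add: less_imp_le)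
      also have "R n \<le> R n * M n" using M[of n] by simp
      finally show ?thesis by simp
    qed
    finally have "q n \<le> 2 * R n * M n" by simp
    then show ?thesis by (metis of_nat_le_iff of_nat_mult of_nat_numeral)
  qed
  \<comment> \<open>\<open>G\<close> runs one index ahead of \<open>P\<close>: the factor
    \<open>q n / M n\<close> brings in \<open>R n\<close>, whereas \<open>P n\<close> contains only
    the bases before \<open>q n\<close>.\<close>
  have "\<exists>C>0. \<forall>n. G (Suc n) \<le> C * P n powr (1 - s)"
  proof (rule eventually_ratio_imp_bound)
    show "\<forall>\<^sub>F n in sequentially. G (Suc (Suc n)) / G (Suc n) \<le> P (Suc n) powr (1 - s) / P n powr (1 - s)"
      using slow
    proof eventually_elim
      case (elim n)
      have "G (Suc (Suc n)) = G (Suc n) * (2 * real (R (Suc n)))" by (simp add: G_def)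
      moreover have "P (Suc n) powr (1 - s) = P n powr (1 - s) * real (q n) powr (1 - s)"
        by (simp add: P_def powr_mult prod_nonneg)
      ultimately show ?case using elim G[of "Suc n"] P[of n] by simp
    qed
  qed (use G P in \<open>auto simp: less_imp_neq[THEN not_sym]\<close>)
  then obtain C where C: "0 < C" and GC: "\<And>n. G (Suc n) \<le> C * P n powr (1 - s)" by blast
  have "(2 * P n * (real (q n) / real (M n))) powr s \<le> 2 * C * real (\<Prod>i<n. M i)" for n
  proof -
    have PG: "P n \<le> G n * real (\<Prod>i<n. M i)"
    proof -
      have "P n \<le> (\<Prod>i<n. 2 * real (R i) * real (M i))"
        unfolding P_def of_nat_prod using ratio by (intro prod_mono) auto
      then show ?thesis by (simp add: G_def prod.distrib)
    qed
    have "real (q n) / real (M n) \<le> 2 * real (R n)" using ratio[of n] M[of n] by (simp add: field_simps)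
    then have "2 * P n * (real (q n) / real (M n)) \<le> P n * (2 * (2 * real (R n)))"
      using mult_left_mono[of "real (q n) / real (M n)" "2 * real (R n)" "2 * P n"] P[of n] by simp
    then have "(2 * P n * (real (q n) / real (M n))) powr s \<le> (P n * (2 * (2 * real (R n)))) powr s"
      using s P[of n] by (intro powr_mono2) auto
    also have "\<dots> = P n powr s * (2 * (2 * real (R n))) powr s"
      by (rule powr_mult)
    also have "\<dots> \<le> P n powr s * (2 * (2 * real (R n))) powr 1"
      using s R(1)[of n] by (intro mult_left_mono powr_mono) auto
    \<comment> \<open>Multiplying by \<open>G n\<close> completes the factor \<open>R n\<close> to
      \<open>G (Suc n)\<close>; \<open>G n\<close> is cancelled at the end.\<close>
    finally have "(2 * P n * (real (q n) / real (M n))) powr s * G n \<le> P n powr s * (2 * (2 * real (R n))) * G n"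
      using G[of n] Rpos[of n] by (intro mult_right_mono) auto
    also have "\<dots> = 2 * P n powr s * G (Suc n)" by (simp add: G_def)
    also have "\<dots> \<le> 2 * P n powr s * (C * P n powr (1 - s))" by (intro mult_left_mono GC) simp
    also have "\<dots> = 2 * C * P n" using P[of n] by (simp flip: powr_add)
    also have "\<dots> \<le> 2 * C * (G n * real (\<Prod>i<n. M i))" using PG C by (intro mult_left_mono) auto
    finally have "(2 * P n * (real (q n) / real (M n))) powr s * G n \<le> 2 * C * real (\<Prod>i<n. M i) * G n"
      by (simp only: mult_ac)
    then show ?thesis using G[of n] by (rule mult_right_le_imp_le)
  qed
  then show ?thesis using C unfolding M_def P_def by (intro exI[of _ "2 * C"]) auto
qed

text \<open>
  Both \<open>q n\<close> and \<open>q (n - 1)\<close> enter: the former since \<open>R n \<le> q n\<close>, the latter since a single factor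
  \<open>q n\<close> may dwarf the product of all earlier ones.
\<close>
lemma slow_divisors_exist:
  fixes q :: "nat \<Rightarrow> nat"
  assumes q: "\<And>n. 2 \<le> q n" and lim: "filterlim q at_top sequentially"
  obtains R where "\<And>n. 2 \<le> R n" "\<And>n. R n \<le> q n" "filterlim R at_top sequentially"
    "\<forall>\<^sub>F n in sequentially. 2 * R n \<le> q n"
    "\<And>\<epsilon>. 0 < \<epsilon> \<Longrightarrow> \<forall>\<^sub>F n in sequentially. 2 * real (R (Suc n)) \<le> real (q n) powr \<epsilon>"
proof -
  define l where "l n = nat \<lfloor>ln (real (q n))\<rfloor>" for n
  \<comment> \<open>The logarithm grows more slowly than every positive power. The minimum ties
    \<open>R n\<close> to both \<open>q n\<close> and its predecessor; the maximum enforces the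
    lower bound 2.\<close>
  define R where "R n = max 2 (min (l n) (l (n - 1)))" for n
  have ql: "filterlim (\<lambda>n. real (q n)) at_top sequentially"
    using lim by (rule filterlim_compose[OF filterlim_real_sequentially])
  have l_le: "real (l n) \<le> ln (real (q n))" for n
    using q[of n] unfolding l_def by simp
  have l_q: "l n \<le> q n" for n
    using l_le[of n] ln_le_minus_one[of "real (q n)"] q[of n] by linarith
  have l_top: "filterlim l at_top sequentially"
    unfolding l_def by (rule filterlim_compose[OF _ ql]) real_asymp
  show ?thesis
  proof
    show "2 \<le> R n" for n by (simp add: R_def)
    show "R n \<le> q n" for n using q[of n] l_q[of n] by (simp add: R_def)
    show "filterlim R at_top sequentially"
      unfolding filterlim_at_top
    proof
      fix Z
      have "filterlim (\<lambda>n. l (n - 1)) at_top sequentially"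
        by (rule filterlim_compose[OF l_top filterlim_minus_const_nat_at_top])
      then have "\<forall>\<^sub>F n in sequentially. Z \<le> l n \<and> Z \<le> l (n - 1)"
        using l_top unfolding filterlim_at_top by (auto intro: eventually_conj)
      then show "\<forall>\<^sub>F n in sequentially. Z \<le> R n"
        by eventually_elim (auto simp: R_def)
    qed
    have "\<forall>\<^sub>F x :: real in at_top. 2 * max 2 (ln x) \<le> x" by real_asymp
    then have "\<forall>\<^sub>F n in sequentially. 2 * max 2 (ln (real (q n))) \<le> real (q n)"
      using ql unfolding filterlim_iff by blast
    then show "\<forall>\<^sub>F n in sequentially. 2 * R n \<le> q n"
    proof eventually_elim
      case (elim n)
      have "real (R n) \<le> max 2 (ln (real (q n)))" using l_le[of n] unfolding R_def by linarith
      then show ?case using elim by linarith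
    qed
    fix \<epsilon> :: real assume "0 < \<epsilon>"
    then have "\<forall>\<^sub>F x :: real in at_top. 2 * max 2 (ln x) \<le> x powr \<epsilon>" by real_asymp
    then have "\<forall>\<^sub>F n in sequentially. 2 * max 2 (ln (real (q n))) \<le> real (q n) powr \<epsilon>"
      using ql unfolding filterlim_iff by blast
    then show "\<forall>\<^sub>F n in sequentially. 2 * real (R (Suc n)) \<le> real (q n) powr \<epsilon>"
    proof eventually_elim
      case (elim n)
      have "real (R (Suc n)) \<le> max 2 (ln (real (q n)))" using l_le[of n] unfolding R_def diff_Suc_1 by linarith
      then show ?case using elim by linarith
    qed
  qed
qed

section \<open>Assembling the set of dimension 1\<close>

theorem mainTheorem3:
  fixes Q :: "nat \<Rightarrow> nat" and f :: "real \<Rightarrow> real"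
  assumes "basic_sequence Q" and "infinite_in_limit Q" and "is_adf f"
  shows "hausdorff_dim {x :: real. has_adf (\<lambda>n. cantor_T Q n x) f} = 1"
proof -
  \<comment> \<open>Reindexing from 0 turns the product of \<open>Q 1\<close>, ...,
    \<open>Q n\<close> into the product of \<open>q i\<close> over \<open>i < n\<close>.\<close>
  define q where "q n = Q (Suc n)" for n
  have q2: "2 \<le> q n" for n using assms(1) by (simp add: q_def basic_sequence_def)
  have "filterlim q at_top sequentially"
    using assms(2) unfolding infinite_in_limit_def q_def by (rule filterlim_compose[OF _ filterlim_Suc])
  from slow_divisors_exist[OF q2 this]
  obtain R where R: "\<And>n. 2 \<le> R n" "\<And>n. R n \<le> q n" "filterlim R at_top sequentially"
    "\<forall>\<^sub>F n in sequentially. 2 * R n \<le> q n"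
    and slow: "\<And>\<epsilon>. 0 < \<epsilon> \<Longrightarrow> \<forall>\<^sub>F n in sequentially. 2 * real (R (Suc n)) \<le> real (q n) powr \<epsilon>"
    by blast
  define M where "M n = q n div R n" for n
  have M_pos: "0 < M n" for n unfolding M_def using R(1,2)[of n] by (simp add: div_greater_zero_iff)
  have MR: "M n * R n \<le> q n" for n unfolding M_def by (simp add: div_times_less_eq_dividend)
  have M_half: "2 * M n \<le> q n" for n
    using MR[of n] mult_le_mono2[OF R(1)[of n], of "M n"] by linarith
  have M_less: "M n < q n" for n using M_half[of n] M_pos[of n] by linarith
  have M2: "\<forall>\<^sub>F n in sequentially. 2 \<le> M n"
    using R(4)
  proof eventually_elim
    case (elim n)
    then have "2 * R n div R n \<le> q n div R n" by (rule div_le_mono)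
    then show ?case using R(1)[of n] by (simp add: M_def)
  qed
  have "(\<lambda>n. (real (M n) + 1) / real (q n)) \<longlonglongrightarrow> 0"
  proof (rule Lim_null_comparison)
    have "filterlim (\<lambda>n. real (R n)) at_top sequentially"
      using R(3) by (rule filterlim_compose[OF filterlim_real_sequentially])
    then show "(\<lambda>n. 2 / real (R n)) \<longlonglongrightarrow> 0"
      by (intro tendsto_divide_0[OF tendsto_const] filterlim_at_top_imp_at_infinity)
    show "\<forall>\<^sub>F n in sequentially. norm ((real (M n) + 1) / real (q n)) \<le> 2 / real (R n)"
    proof (intro always_eventually allI)
      fix n
      \<comment> \<open>As \<open>M n\<close> is at least 1, \<open>M n + 1\<close> is at most twice
        \<open>M n\<close>; so the window widths are of order \<open>1 / R n\<close> and tend to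
        0.\<close>
      have "(real (M n) + 1) * real (R n) \<le> 2 * (real (M n) * real (R n))"
        using M_pos[of n] R(1)[of n] mult_right_mono[of 1 "real (M n)" "real (R n)"] by (simp add: distrib_right)
      also have "real (M n) * real (R n) \<le> real (q n)" using MR[of n] by (metis of_nat_le_iff of_nat_mult)
      finally show "norm ((real (M n) + 1) / real (q n)) \<le> 2 / real (R n)"
        using R(1)[of n] q2[of n] by (simp add: field_simps)
    qed
  qed
  then obtain a where a: "\<And>n. a n + M n < q n"
    and adf: "\<And>T. (\<And>n. real (a n) / real (q n) \<le> T n) \<Longrightarrow> (\<And>n. T n \<le> real (a n + M n) / real (q n)) \<Longrightarrow> has_adf T f"
    using digit_windows_for_adf[where q = q and M = M, OF assms(3) M_less] by blast
  interpret digit_windows q M a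
    using M_pos M_half a M2 by unfold_locales auto
  have T: "cantor_T Q n (embed t) = embed_tail t n" for n t
  proof -
    have "(\<Prod>i=1..n. Q i) = (\<Prod>i<n. q i)"
      unfolding q_def by (intro prod.reindex_bij_witness[of _ Suc "\<lambda>i. i - 1"]) auto
    then show ?thesis unfolding cantor_T_def using frac_embed[of n t] by simp
  qed
  have "has_adf (\<lambda>n. cantor_T Q n (embed t)) f" for t
    unfolding T by (intro adf embed_tail_window)
  then have mem: "embed t \<in> {x. has_adf (\<lambda>n. cantor_T Q n x) f}" for t by simp
  show ?thesis
  proof (rule hausdorff_dim_real_eq_1)
    fix s :: real assume s: "0 \<le> s" "s < 1"
    show "hausdorff_measure s {x :: real. has_adf (\<lambda>n. cantor_T Q n x) f} \<noteq> 0"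
    proof (cases "s = 0")
      case True
      then show ?thesis using mem by (auto intro!: hausdorff_measure_0_nonempty)
    next
      case False
      then have s0: "0 < s" using s by simp
      obtain C where C: "0 < C" and growth: "\<And>n. (2 * real (\<Prod>i<n. q i) * (real (q n) / real (M n))) powr s
          \<le> C * real (\<Prod>i<n. M i)"
        using digit_count_growth[OF R(1,2) s0 s(2) slow[of "1 - s"]] s(2) unfolding M_def by auto
      show ?thesis
      proof (rule hausdorff_measure_pos_of_inverse_Holder[OF s0])
        show "0 < 2 * C" using C by simp
        show "embed ` {0..<1} \<subseteq> {x. has_adf (\<lambda>n. cantor_T Q n x) f}" using mem by blast
        show "\<bar>t - t'\<bar> \<le> 2 * C * dist (embed t) (embed t') powr s"
          if "t \<in> {0..<1}" "t' \<in> {0..<1}" for t t'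
          using embed_inverse_Holder[OF s0 _ C growth that] s by simp
      qed
    qed
  qed
qed

end
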